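(* Let $(X,\rho)$ be a complete metric space and let $T:X\to X$ be a map with the following properties: (a) there exist subsets $U_n\subseteq X$, $n\in\mathbb{N}$, such that $T(U_n)\subseteq U_n$ for every $n\in\mathbb{N}$, and $\bigcap_{n=1}^\infty U_n\neq\emptyset$; (b) there exists $\alpha\in(0,1)$ such that for every $x\in X$ there are $n_1,n_0\in\mathbb{N}$ (depending on $x$) such that for every $u\in\bigcup_{n=n_0}^\infty U_n$ the inequality $$\rho(T^{n_1}u,T^{n_1}x)\leq\alpha\,\rho(u,x)$$ holds. Then there exists $z\in X$ with the following properties: (i) there exists $n_z\in\mathbb{N}$ such that $T^{n_z}z=z$; (ii) for every $y\in X$ there is a sequence of natural numbers $\{q_i\}_{i=1}^\infty$ such that $\lim_{i\to\infty}T^{q_i}y=z$; (iii) for every $x\in\bigcap_{n=1}^\infty U_n$ one has $\lim_{n\to\infty}T^nx=z$.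
   Context: $\mathbb{N}=\{1,2,3,\dots\}$ denotes the positive integers. $T^n$ denotes the $n$-fold iterate of $T$, i.e. $T^1x=Tx$ and $T^nx=T(T^{n-1}x)$. No continuity of $T$ is assumed, the sets $U_n$ are not assumed to be nested or closed, and the same sets $U_n$ are used in (a), (b) and (iii). *)

theory Defs
  imports Complex_Main
begin

end

theory Submission
  imports Defs
begin

text \<open>
  The argument is Sehgal's and Guseman's fixed point argument for maps with a contractive
  iterate at each point, except that the contraction at a point \<open>x\<close> compares \<open>x\<close>
  only with the points of the invariant set \<open>W = (\<Inter>n\<ge>1. U n)\<close>, and \<open>W\<close> need not be closed.

  Every point \<open>y\<close> prescribes its own sequence of times: run \<open>T\<close> for as many steps as the point
  \<open>y\<close> asks for, then for as many as the point so reached asks for, and so on. When a point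
  \<open>u \<in> W\<close> is moved by the times that \<open>y\<close> prescribes, it stays in \<open>W\<close>, so each stage shrinks the
  distance between the two moving points by the factor \<open>\<alpha>\<close> (\<open>dist_visit_time_le\<close>). The
  claims about limits come from this estimate.

  With \<open>u\<close> in the role of \<open>y\<close> and the later points of its orbit in the role of \<open>u\<close>, the estimate
  shows that tails of the orbit of \<open>u\<close> have small diameter, provided that the orbit is bounded
  (\<open>orbit_bounded\<close>); so orbits in \<open>W\<close> converge. With \<open>y\<close> arbitrary, it shows that the
  orbit of \<open>y\<close> approaches, along the times prescribed by \<open>y\<close>, the limit of any orbit in \<open>W\<close>; in
  particular all orbits in \<open>W\<close> have one limit \<open>z\<close>. The contraction at the point \<open>z\<close> itself says
  that its iterate \<open>T ^^ n1\<close> sends orbit points near \<open>z\<close> to points near \<open>(T ^^ n1) z\<close>, and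
  this replaces continuity in the proof that \<open>(T ^^ n1) z = z\<close>.
\<close>

locale pointwise_contractive_iterate =
  fixes T :: "'a::metric_space \<Rightarrow> 'a"
    and W :: "'a set"
    and \<alpha> :: real
    and m :: "'a \<Rightarrow> nat"
  assumes invariant: "u \<in> W \<Longrightarrow> T u \<in> W"
    and alpha_pos: "0 < \<alpha>"
    and alpha_less_1: "\<alpha> < 1"
    and m_pos: "1 \<le> m x"
    and contract: "u \<in> W \<Longrightarrow> dist ((T ^^ m x) u) ((T ^^ m x) x) \<le> \<alpha> * dist u x"
begin

lemma funpow_invariant: "u \<in> W \<Longrightarrow> (T ^^ n) u \<in> W"
  by (induction n) (auto intro: invariant)

primrec visit_time :: "'a \<Rightarrow> nat \<Rightarrow> nat" where
  "visit_time y 0 = 0"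
| "visit_time y (Suc i) = m ((T ^^ visit_time y i) y) + visit_time y i"

lemma strict_mono_visit_time: "strict_mono (visit_time y)"
  unfolding strict_mono_Suc_iff using m_pos by (simp add: Suc_le_eq)

lemma dist_visit_time_le:
  assumes "u \<in> W"
  shows "dist ((T ^^ visit_time y i) u) ((T ^^ visit_time y i) y) \<le> \<alpha> ^ i * dist u y"
proof (induction i)
  case (Suc i)
  let ?q = "visit_time y i"
  have "dist ((T ^^ visit_time y (Suc i)) u) ((T ^^ visit_time y (Suc i)) y)
      \<le> \<alpha> * dist ((T ^^ ?q) u) ((T ^^ ?q) y)"
    using contract[OF funpow_invariant[OF assms]] by (simp add: funpow_add)
  also have "\<dots> \<le> \<alpha> * (\<alpha> ^ i * dist u y)"
    using Suc.IH alpha_pos by (simp add: mult_left_mono)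
  finally show ?case by (simp add: mult.assoc)
qed simp

text \<open>
  If a point of the orbit is at distance \<open>d\<close> from \<open>u\<close>, then after \<open>m u\<close> further steps the
  distance is at most \<open>\<alpha> * d + c\<close>, where \<open>c\<close> is the distance from \<open>(T ^^ m u) u\<close> to \<open>u\<close>. The
  map \<open>d \<mapsto> \<alpha> * d + c\<close>
  preserves every interval \<open>{0..r}\<close> with \<open>r \<ge> c / (1 - \<alpha>)\<close>, so it suffices to choose \<open>r\<close> that
  also bounds the finitely many distances with \<open>n < m u\<close>.
\<close>

lemma orbit_bounded:
  assumes "u \<in> W"
  shows "\<exists>r. \<forall>n. dist ((T ^^ n) u) u \<le> r"
proof -
  define c where "c = dist ((T ^^ m u) u) u"
  define S where "S = (\<Sum>n<m u. dist ((T ^^ n) u) u)"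
  define r where "r = S + c / (1 - \<alpha>)"
  have one_minus: "1 - \<alpha> > 0" using alpha_less_1 by simp
  have "S \<ge> 0" "c \<ge> 0" by (simp_all add: S_def c_def sum_nonneg)
  have r_ge: "c / (1 - \<alpha>) \<le> r" using \<open>S \<ge> 0\<close> by (simp add: r_def)
  have c_le: "c \<le> (1 - \<alpha>) * r"
    using r_ge one_minus by (simp add: field_simps)
  have "dist ((T ^^ n) u) u \<le> r" for n
  proof (induction n rule: less_induct)
    case (less n)
    show ?case
    proof (cases "n < m u")
      case True
      have "dist ((T ^^ n) u) u \<le> S"
        unfolding S_def by (rule member_le_sum) (use True in auto)
      then show ?thesis using \<open>c \<ge> 0\<close> one_minus by (simp add: r_def add_increasing2)
    next
      case False
      define k where "k = n - m u"
      have n: "n = m u + k" and "k < n"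
        using False m_pos[of u] by (auto simp: k_def)
      have "dist ((T ^^ n) u) u \<le> dist ((T ^^ n) u) ((T ^^ m u) u) + c"
        unfolding c_def by (rule dist_triangle)
      also have "\<dots> \<le> \<alpha> * dist ((T ^^ k) u) u + c"
        using contract[OF funpow_invariant[OF assms], of u k] by (simp add: n funpow_add)
      also have "\<dots> \<le> \<alpha> * r + (1 - \<alpha>) * r"
        using less.IH[OF \<open>k < n\<close>] c_le alpha_pos by (intro add_mono mult_left_mono) auto
      finally show ?thesis by (simp add: algebra_simps)
    qed
  qed
  then show ?thesis by blast
qed

lemma Cauchy_orbit:
  assumes "u \<in> W"
  shows "Cauchy (\<lambda>n. (T ^^ n) u)"
proof -
  obtain r where r: "\<forall>n. dist ((T ^^ n) u) u \<le> r"
    using orbit_bounded[OF assms] by blast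
  have tail: "dist ((T ^^ n) u) ((T ^^ visit_time u i) u) \<le> \<alpha> ^ i * r"
    if le: "visit_time u i \<le> n" for n i
  proof -
    obtain k where n: "n = visit_time u i + k" using le_Suc_ex[OF le] by blast
    have "dist ((T ^^ n) u) ((T ^^ visit_time u i) u) \<le> \<alpha> ^ i * dist ((T ^^ k) u) u"
      using dist_visit_time_le[OF funpow_invariant[OF assms], of u i k]
      by (simp add: n funpow_add)
    also have "\<dots> \<le> \<alpha> ^ i * r" using r alpha_pos by (simp add: mult_left_mono)
    finally show ?thesis .
  qed
  have lim: "(\<lambda>i. \<alpha> ^ i * r) \<longlonglongrightarrow> 0"
    using alpha_pos alpha_less_1 by (intro tendsto_mult_left_zero LIMSEQ_realpow_zero) auto
  show ?thesis
    unfolding Cauchy_altdef2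
  proof (intro allI impI)
    fix e :: real
    assume "e > 0"
    then obtain i where "\<alpha> ^ i * r < e"
      using order_tendstoD(2)[OF lim] by (auto simp: eventually_sequentially)
    then show "\<exists>N. \<forall>n\<ge>N. dist ((T ^^ n) u) ((T ^^ N) u) < e"
      using tail by (meson le_less_trans)
  qed
qed

lemma visits_converge:
  assumes "u \<in> W" and lim: "(\<lambda>n. (T ^^ n) u) \<longlonglongrightarrow> z"
  shows "(\<lambda>i. (T ^^ visit_time y i) y) \<longlonglongrightarrow> z"
proof -
  have "(\<lambda>i. \<alpha> ^ i * dist u y) \<longlonglongrightarrow> 0"
    using alpha_pos alpha_less_1 by (intro tendsto_mult_left_zero LIMSEQ_realpow_zero) auto
  moreover have "(\<lambda>i. dist ((T ^^ visit_time y i) u) z) \<longlonglongrightarrow> 0"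
    using LIMSEQ_subseq_LIMSEQ[OF lim strict_mono_visit_time]
    by (simp add: o_def tendsto_dist_iff[symmetric])
  ultimately have bound_lim:
    "(\<lambda>i. \<alpha> ^ i * dist u y + dist ((T ^^ visit_time y i) u) z) \<longlonglongrightarrow> 0"
    by (rule tendsto_add_zero)
  have "dist ((T ^^ visit_time y i) y) z
      \<le> \<alpha> ^ i * dist u y + dist ((T ^^ visit_time y i) u) z" for i
    using dist_triangle2[of "(T ^^ visit_time y i) y" z "(T ^^ visit_time y i) u"]
      dist_visit_time_le[OF \<open>u \<in> W\<close>, of y i]
    by (simp add: dist_commute)
  then have "(\<lambda>i. dist ((T ^^ visit_time y i) y) z) \<longlonglongrightarrow> 0"
    by (intro tendsto_sandwich[OF _ _ tendsto_const bound_lim]) (auto intro: always_eventually)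
  then show ?thesis by (simp add: tendsto_dist_iff[symmetric])
qed

text \<open>
  By the contraction at \<open>z\<close>, the orbit shifted by \<open>m z\<close> steps converges to \<open>(T ^^ m z) z\<close>;
  being a shift of the orbit, it also converges to \<open>z\<close>.
\<close>

lemma limit_periodic:
  assumes "u \<in> W" and lim: "(\<lambda>n. (T ^^ n) u) \<longlonglongrightarrow> z"
  shows "(T ^^ m z) z = z"
proof -
  have bound_lim: "(\<lambda>n. \<alpha> * dist ((T ^^ n) u) z) \<longlonglongrightarrow> 0"
    by (rule tendsto_mult_right_zero[OF lim[THEN tendsto_dist_iff[THEN iffD1]]])
  have "dist ((T ^^ (n + m z)) u) ((T ^^ m z) z) \<le> \<alpha> * dist ((T ^^ n) u) z" for n
    using contract[OF funpow_invariant[OF \<open>u \<in> W\<close>], of z n]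
    by (simp add: add.commute[of n] funpow_add)
  then have "(\<lambda>n. dist ((T ^^ (n + m z)) u) ((T ^^ m z) z)) \<longlonglongrightarrow> 0"
    by (intro tendsto_sandwich[OF _ _ tendsto_const bound_lim]) (auto intro: always_eventually)
  then have "(\<lambda>n. (T ^^ (n + m z)) u) \<longlonglongrightarrow> (T ^^ m z) z"
    by (rule tendsto_dist_iff[THEN iffD2])
  moreover have "(\<lambda>n. (T ^^ (n + m z)) u) \<longlonglongrightarrow> z"
    by (rule LIMSEQ_ignore_initial_segment[OF lim])
  ultimately show ?thesis by (rule LIMSEQ_unique)
qed

end

theorem theorem2p1:
  fixes T :: "'a::complete_space \<Rightarrow> 'a"
    and U :: "nat \<Rightarrow> 'a set"
    and \<alpha> :: real
  assumes U_invariant: "\<And>n. n \<ge> 1 \<Longrightarrow> T ` U n \<subseteq> U n"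
    and U_Inter: "(\<Inter>n\<in>{1..}. U n) \<noteq> {}"
    and alpha: "\<alpha> \<in> {0<..<1}"
    and contraction: "\<And>x. \<exists>n1\<ge>1. \<exists>n0\<ge>1. \<forall>u\<in>(\<Union>n\<in>{n0..}. U n).
          dist ((T ^^ n1) u) ((T ^^ n1) x) \<le> \<alpha> * dist u x"
  shows "\<exists>z. (\<exists>nz\<ge>1. (T ^^ nz) z = z)
           \<and> (\<forall>y. \<exists>q :: nat \<Rightarrow> nat. (\<forall>i. q i \<ge> 1) \<and> (\<lambda>i. (T ^^ q i) y) \<longlonglongrightarrow> z)
           \<and> (\<forall>x\<in>(\<Inter>n\<in>{1..}. U n). (\<lambda>n. (T ^^ n) x) \<longlonglongrightarrow> z)"
proof -
  define W where "W = (\<Inter>n\<in>{1..}. U n)"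
  have "\<exists>k\<ge>1. \<forall>u\<in>W. dist ((T ^^ k) u) ((T ^^ k) x) \<le> \<alpha> * dist u x" for x
  proof -
    obtain n1 n0 where "n1 \<ge> 1" "n0 \<ge> 1"
      and *: "\<forall>u\<in>(\<Union>n\<in>{n0..}. U n). dist ((T ^^ n1) u) ((T ^^ n1) x) \<le> \<alpha> * dist u x"
      using contraction[of x] by blast
    have "W \<subseteq> (\<Union>n\<in>{n0..}. U n)" using \<open>n0 \<ge> 1\<close> by (auto simp: W_def)
    then show ?thesis using * \<open>n1 \<ge> 1\<close> by blast
  qed
  then obtain m where m: "\<And>x. m x \<ge> 1"
    "\<And>x u. u \<in> W \<Longrightarrow> dist ((T ^^ m x) u) ((T ^^ m x) x) \<le> \<alpha> * dist u x"
    by metis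
  have "T v \<in> W" if "v \<in> W" for v
    using that U_invariant unfolding W_def by blast
  then interpret pointwise_contractive_iterate T W \<alpha> m
    using alpha m by unfold_locales auto
  obtain u where "u \<in> W" using U_Inter by (auto simp: W_def)
  obtain z where z: "(\<lambda>n. (T ^^ n) u) \<longlonglongrightarrow> z"
    using Cauchy_convergent[OF Cauchy_orbit[OF \<open>u \<in> W\<close>]] unfolding convergent_def by blast
  have visits: "(\<lambda>i. (T ^^ visit_time y i) y) \<longlonglongrightarrow> z" for y
    by (rule visits_converge[OF \<open>u \<in> W\<close> z])
  have "\<exists>q :: nat \<Rightarrow> nat. (\<forall>i. q i \<ge> 1) \<and> (\<lambda>i. (T ^^ q i) y) \<longlonglongrightarrow> z" for y
  proof (intro exI conjI allI)
    \<comment> \<open>The times start at \<open>visit_time y 0 = 0\<close>, so they are shifted to become positive.\<close>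
    show "visit_time y (Suc i) \<ge> 1" for i using m(1) by (simp add: trans_le_add1)
    show "(\<lambda>i. (T ^^ visit_time y (Suc i)) y) \<longlonglongrightarrow> z"
      by (rule LIMSEQ_Suc[OF visits])
  qed
  moreover have "(\<lambda>n. (T ^^ n) x) \<longlonglongrightarrow> z" if x: "x \<in> W" for x
  proof -
    obtain z' where z': "(\<lambda>n. (T ^^ n) x) \<longlonglongrightarrow> z'"
      using Cauchy_convergent[OF Cauchy_orbit[OF x]] unfolding convergent_def by blast
    \<comment> \<open>The visits of \<open>x\<close> form a subsequence of its orbit, so the two limits agree.\<close>
    have "(\<lambda>i. (T ^^ visit_time x i) x) \<longlonglongrightarrow> z'" by (rule visits_converge[OF x z'])
    then show ?thesis using z' LIMSEQ_unique[OF _ visits] by blast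
  qed
  ultimately show ?thesis
    using limit_periodic[OF \<open>u \<in> W\<close> z] m(1)[of z] unfolding W_def by blast
qed

end
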